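(* Let $K$ be a totally real number field with ring of integers $\mathcal{O}_K$. For every totally positive $\alpha \in \mathcal{O}_K$, \[ \alpha\, p_K(\alpha) = \sum_{0 \prec \beta \preceq \alpha} \sigma_K(\beta)\, p_K(\alpha-\beta), \] where the sum runs over all totally positive $\beta \in \mathcal{O}_K$ with $\beta \preceq \alpha$.
   Context: An element $\gamma\in K$ is totally positive if $\sigma(\gamma)>0$ for every real embedding $\sigma$ of $K$; write $\mathcal{O}_K^+$ for the set of totally positive elements of $\mathcal{O}_K$. For $\gamma,\delta\in K$, $\gamma \succ \delta$ means $\gamma-\delta$ is totally positive, and $\gamma\succeq\delta$ means $\gamma\succ\delta$ or $\gamma=\delta$. A partition of $\alpha\in\mathcal{O}_K^+$ is an expression $\alpha=\alpha_1+\dots+\alpha_n$ with $n\ge1$ and all $\alpha_i\in\mathcal{O}_K^+$, where the order of the summands is irrelevant; $p_K(\alpha)$ denotes the number of partitions of $\alpha$, and $p_K(0)=1$. For $\beta\in\mathcal{O}_K$, $\sigma_K(\beta) := \sum_{n\in\mathbb{Z}_{\ge1},\, n\mid\beta} \beta/n$, where $n\mid\beta$ means divisibility in $\mathcal{O}_K$ (i.e. $\beta/n\in\mathcal{O}_K$). *)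

theory Defs
  imports "HOL-Library.Multiset" "Subresultants.More_Homomorphisms"
begin

text \<open>
  A number field is a type of class \<open>field_char_0\<close> satisfying the following predicate; the real
  (complex) embeddings are the field homomorphisms from that type into the reals (complex numbers).
\<close>

definition number_field :: "'k :: field_char_0 itself \<Rightarrow> bool" where
  "number_field _ \<longleftrightarrow>
     (\<exists>B :: 'k set. finite B \<and> module.span (\<lambda>(q :: rat) x. of_rat q * x) B = UNIV)"

definition totally_real :: "'k :: field_char_0 itself \<Rightarrow> bool" where
  "totally_real _ \<longleftrightarrow> (\<forall>\<sigma> :: 'k \<Rightarrow> complex. field_hom \<sigma> \<longrightarrow> range \<sigma> \<subseteq> \<real>)"

definition ring_of_integers :: "'k :: field_char_0 set" where
  "ring_of_integers = {x. algebraic_int x}"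

definition totally_positive :: "'k :: field_char_0 \<Rightarrow> bool" where
  "totally_positive \<gamma> \<longleftrightarrow> (\<forall>\<sigma> :: 'k \<Rightarrow> real. field_hom \<sigma> \<longrightarrow> \<sigma> \<gamma> > 0)"

definition pos_integers :: "'k :: field_char_0 set" where
  "pos_integers = {x \<in> ring_of_integers. totally_positive x}"

definition tp_greater :: "'k :: field_char_0 \<Rightarrow> 'k \<Rightarrow> bool" (infix "\<succ>" 50) where
  "\<gamma> \<succ> \<delta> \<longleftrightarrow> totally_positive (\<gamma> - \<delta>)"

definition tp_greater_eq :: "'k :: field_char_0 \<Rightarrow> 'k \<Rightarrow> bool" (infix "\<succeq>" 50) where
  "\<gamma> \<succeq> \<delta> \<longleftrightarrow> \<gamma> \<succ> \<delta> \<or> \<gamma> = \<delta>"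

text \<open>
  Unordered sums of \<open>n \<ge> 1\<close> terms are non-empty multisets.
\<close>

definition partitions :: "'k :: field_char_0 \<Rightarrow> 'k multiset set" where
  "partitions \<alpha> = {A. A \<noteq> {#} \<and> set_mset A \<subseteq> pos_integers \<and> \<Sum>\<^sub># A = \<alpha>}"

definition num_partitions :: "'k :: field_char_0 \<Rightarrow> nat" where
  "num_partitions \<alpha> = (if \<alpha> = 0 then 1 else card (partitions \<alpha>))"

text \<open>
  The index set is finite for every nonzero \<open>\<beta>\<close> in the ring of integers; for \<open>\<beta> = 0\<close> it is
  infinite and all terms vanish.
\<close>

definition divisor_sum :: "'k :: field_char_0 \<Rightarrow> 'k" where
  "divisor_sum \<beta> =
     (\<Sum>n \<in> {n :: nat. n \<ge> 1 \<and> \<beta> / of_nat n \<in> ring_of_integers}. \<beta> / of_nat n)"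

end

theory Submission
  imports Defs "HOL-Computational_Algebra.Fundamental_Theorem_Algebra"
begin

text \<open>
  Every complex root of the minimal polynomial of \<open>\<beta>\<close> is the image of \<open>\<beta>\<close> under an embedding of the
  number field. If the field is totally real, the conjugates of an integer \<open>\<beta>\<close> with
  \<open>0 \<prec> \<beta> \<preceq> \<alpha>\<close> thus lie between \<open>0\<close> and those of \<open>\<alpha>\<close>, which bounds the coefficients of
  its (integral) minimal polynomial, so there are only finitely many such \<open>\<beta>\<close>, and \<open>\<alpha>\<close> has
  finitely many partitions. Adding up all partitions of \<open>\<alpha>\<close> gives
  \<open>\<alpha> p(\<alpha>) = \<Sum>\<gamma>. \<gamma> \<cdot> (total multiplicity of \<gamma>)\<close>. Removing \<open>n\<close> copies of \<open>\<gamma>\<close> shows that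
  \<open>p(\<alpha> - n \<gamma>)\<close> partitions contain \<open>\<gamma>\<close> at least \<open>n\<close> times, so the total multiplicity is
  \<open>\<Sum>n\<ge>1. p(\<alpha> - n \<gamma>)\<close>, and grouping the terms by \<open>\<beta> = n \<gamma>\<close> gives the divisor sum.
\<close>

hide_const (open) Module.smult

subsection \<open>Minimal polynomials\<close>

text \<open>Serves to turn a relation with rational coefficients into one with integer
  coefficients.\<close>

lemma finite_common_denominator:
  fixes u :: "'a \<Rightarrow> rat"
  assumes "finite S"
  shows "\<exists>D :: int. D \<noteq> 0 \<and> (\<forall>i\<in>S. \<exists>k. of_int D * u i = of_int k)"
  using assms
proof induction
  case (insert a S)
  then obtain D :: int where D: "D \<noteq> 0" "\<forall>i\<in>S. \<exists>k. of_int D * u i = of_int k"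
    by blast
  obtain n d where nd: "u a = of_int n / of_int d" "d \<noteq> 0"
    by (metis Fract_of_int_quotient Rat_cases less_irrefl)
  have "\<exists>k. of_int (d * D) * u i = of_int k" if "i \<in> insert a S" for i
  proof (cases "i = a")
    case True
    with nd have "of_int (d * D) * u i = (of_int (D * n) :: rat)"
      by simp
    then show ?thesis ..
  next
    case False
    with D that obtain k where "of_int D * u i = (of_int k :: rat)"
      by blast
    then have "of_int (d * D) * u i = (of_int (d * k) :: rat)"
      by simp
    then show ?thesis ..
  qed
  with D nd show ?case
    by (intro exI[of _ "d * D"]) simp
qed (auto intro: exI[of _ 1])

text \<open>The \<open>card B + 1\<close> powers of \<open>x\<close> up to \<open>x ^ card B\<close>
  lie in a rational vector space spanned by \<open>card B\<close> elements, so they satisfy a linear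
  relation; clearing denominators makes it integral. The bound \<open>d\<close> is uniform in
  \<open>x\<close>, which the finiteness argument relies on.\<close>

lemma number_field_algebraic_bounded_degree:
  assumes "number_field TYPE('k :: field_char_0)"
  obtains d where "\<And>x :: 'k. \<exists>p. p \<noteq> 0 \<and> degree p \<le> d \<and> poly (of_int_poly p) x = 0"
proof -
  interpret Q: vector_space "\<lambda>(q :: rat) x :: 'k. of_rat q * x"
    by unfold_locales (auto simp: algebra_simps of_rat_add of_rat_mult)
  obtain B :: "'k set" where B: "finite B" "Q.span B = UNIV"
    using assms unfolding number_field_def by blast
  have "\<exists>p. p \<noteq> 0 \<and> degree p \<le> card B \<and> poly (of_int_poly p) x = 0" for x :: 'k
  proof (cases "inj_on (\<lambda>i. x ^ i) {..card B}")
    \<comment> \<open>Linear dependence is a property of the set of powers, so coinciding powers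
      would be lost there; they give the relation X^j - X^i directly.\<close>
    case False
    then obtain i j where ij: "i < j" "j \<le> card B" "x ^ i = x ^ j"
      by (metis (no_types, lifting) atMost_iff inj_onI linorder_neqE_nat)
    let ?p = "monom 1 j - monom 1 i :: int poly"
    have "coeff ?p j \<noteq> 0"
      using ij by simp
    then have "?p \<noteq> 0"
      by (metis coeff_0)
    moreover have "degree ?p \<le> card B"
      using ij by (intro degree_diff_le) (auto intro: order_trans[OF degree_monom_le])
    moreover have "poly (of_int_poly ?p) x = 0"
      using ij by (simp add: of_int_poly_hom.hom_minus map_poly_monom poly_monom)
    ultimately show ?thesis by blast
  next
    case True
    let ?P = "(\<lambda>i. x ^ i) ` {..card B}"
    have "Q.dependent ?P"
      using Q.independent_span_bound[OF B(1), of ?P] B(2) card_image[OF True] by auto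
    then obtain u where u: "\<exists>v\<in>?P. u v \<noteq> 0" "(\<Sum>v\<in>?P. of_rat (u v) * v) = 0"
      by (subst (asm) Q.dependent_finite) auto
    obtain D where D: "D \<noteq> 0" "\<forall>v\<in>?P. \<exists>k. of_int D * u v = of_int k"
      using finite_common_denominator[of ?P u] by blast
    then obtain k where k: "\<And>v. v \<in> ?P \<Longrightarrow> of_int D * u v = of_int (k v)"
      by metis
    have k': "of_int (k v) = (of_int D * of_rat (u v) :: 'k)" if "v \<in> ?P" for v
      using k[OF that] by (metis of_rat_mult of_rat_of_int_eq)
    define p where "p = (\<Sum>i\<le>card B. monom (k (x ^ i)) i)"
    have cp: "coeff p i = k (x ^ i)" if "i \<le> card B" for i
      using that by (simp add: p_def coeff_sum coeff_monom sum.delta)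
    have "p \<noteq> 0"
    proof -
      obtain i where i: "i \<le> card B" "u (x ^ i) \<noteq> 0"
        using u by auto
      with k[of "x ^ i"] D have "k (x ^ i) \<noteq> 0"
        by auto
      with cp[OF i(1)] show ?thesis by auto
    qed
    moreover have "degree p \<le> card B"
      unfolding p_def by (intro degree_sum_le) (auto intro: order_trans[OF degree_monom_le])
    moreover have "poly (of_int_poly p) x = (\<Sum>i\<le>card B. of_int (k (x ^ i)) * x ^ i)"
      unfolding p_def by (simp add: of_int_poly_hom.hom_sum poly_sum map_poly_monom poly_monom)
    moreover have "\<dots> = (\<Sum>v\<in>?P. of_int (k v) * v)"
      by (simp add: sum.reindex[OF True])
    moreover have "\<dots> = (\<Sum>v\<in>?P. of_int D * (of_rat (u v) * v))"
      by (intro sum.cong) (auto simp: k')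
    moreover have "\<dots> = 0"
      unfolding sum_distrib_left[symmetric] u(2) by simp
    ultimately show ?thesis by auto
  qed
  then show ?thesis by (rule that)
qed

text \<open>Gauss's lemma: the primitive part \<open>h\<close> of an integer polynomial of least
  degree vanishing at \<open>x\<close> divides the monic polynomial \<open>p\<close>, so its leading
  coefficient is a unit.\<close>

lemma algebraic_int_minimal_polynomial:
  fixes x :: "'k :: field_char_0"
  assumes "algebraic_int x"
  obtains m where "lead_coeff m = 1" "poly (of_int_poly m) x = 0"
    "\<And>p :: int poly. p \<noteq> 0 \<Longrightarrow> poly (of_int_poly p) x = 0 \<Longrightarrow> degree m \<le> degree p"
proof -
  obtain p where p: "poly (of_int_poly p) x = 0" "lead_coeff p = 1"
    using assms unfolding algebraic_int_altdef_ipoly by blast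
  let ?I = "\<lambda>p. p \<noteq> 0 \<and> poly (of_int_poly p) x = 0"
  have "?I p" using p by auto
  from ex_has_least_nat[of ?I, OF this, of degree] obtain g where
    g: "g \<noteq> 0" "poly (of_int_poly g) x = 0" and min: "\<And>q. ?I q \<Longrightarrow> degree g \<le> degree q"
    by blast
  define h where "h = primitive_part g"
  have gh: "g = smult (content g) h" and h: "content h = 1" "h \<noteq> 0" "degree h = degree g"
    using g by (auto simp: h_def)
  have "of_int (content g) * poly (of_int_poly h) x = 0"
    using g(2) by (subst (asm) gh) (simp add: map_poly_smult)
  then have hx: "poly (of_int_poly h) x = 0"
    using g(1) by simp
  \<comment> \<open>Pseudo-division stays inside the integer polynomials at the price of the factor
    \<open>c\<close>; the remainder vanishes at \<open>x\<close> and is therefore 0 by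
    minimality.\<close>
  obtain q r where qr: "pseudo_divmod p h = (q, r)"
    by fastforce
  define c where "c = lead_coeff h ^ (Suc (degree p) - degree h)"
  have c: "c \<noteq> 0"
    unfolding c_def using h(2) by (metis leading_coeff_0_iff power_not_zero)
  have eq: "smult c p = h * q + r" and r: "r = 0 \<or> degree r < degree h"
    using pseudo_divmod[OF h(2) qr] by (auto simp: c_def)
  have "of_int_poly r = (of_int_poly (smult c p) - of_int_poly (h * q) :: 'k poly)"
    unfolding eq by (simp add: of_int_poly_hom.hom_add)
  then have "poly (of_int_poly r) x = 0"
    using p hx by (simp add: of_int_poly_hom.hom_mult map_poly_smult)
  with r min[of r] h(3) have r0: "r = 0"
    by (metis leD)
  \<comment> \<open>Both \<open>p\<close> and \<open>h\<close> are primitive, so comparing contents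
    in \<open>smult c p = h * q\<close> shows that \<open>c\<close> divides \<open>q\<close> and can
    be cancelled.\<close>
  have "content p dvd 1"
    using p(2) by (metis content_dvd_coeff)
  then have "content p = 1"
    by (metis is_unit_normalize normalize_content)
  then have "content q = \<bar>c\<bar>"
    using arg_cong[OF eq, of content] r0 h(1) by (simp add: content_mult)
  moreover define q' where "q' = smult (sgn c) (primitive_part q)"
  ultimately have "q = smult c q'"
    by (metis abs_sgn content_times_primitive_part mult.commute smult_smult)
  with eq r0 c have "p = h * q'"
    by (metis add.right_neutral mult_smult_right smult_cancel)
  with p(2) have "lead_coeff h * lead_coeff q' = 1"
    by (simp add: lead_coeff_mult)
  then have lc: "lead_coeff h * lead_coeff h = 1"
    by (auto simp: zmult_eq_1_iff)
  show ?thesis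
  \<comment> \<open>The leading coefficient is 1 or -1, so multiplying by it makes \<open>h\<close>
    monic.\<close>
  proof (rule that[of "smult (lead_coeff h) h"])
    show "lead_coeff (smult (lead_coeff h) h) = 1"
      using lc h(2) by simp
    show "poly (of_int_poly (smult (lead_coeff h) h)) x = 0"
      using hx by (simp add: map_poly_smult)
    show "degree (smult (lead_coeff h) h) \<le> degree p"
      if "p \<noteq> 0" "poly (of_int_poly p) x = 0" for p
      using min[of p] that h by simp
  qed
qed

subsection \<open>Embeddings of number fields\<close>

text \<open>Intermediate fields are subsets of one type, so polynomials over them are polynomials
  over the big field with restricted coefficients.\<close>

definition poly_over :: "'a :: zero set \<Rightarrow> 'a poly \<Rightarrow> bool" where
  "poly_over F p \<longleftrightarrow> (\<forall>i. coeff p i \<in> F)"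

lemma inverse_in_algebraic_subring:
  fixes F :: "'k :: field_char_0 set"
  assumes rats: "\<rat> \<subseteq> F"
    and add: "\<And>x y. x \<in> F \<Longrightarrow> y \<in> F \<Longrightarrow> x + y \<in> F"
    and mult: "\<And>x y. x \<in> F \<Longrightarrow> y \<in> F \<Longrightarrow> x * y \<in> F"
    and "z \<in> F" "algebraic z"
  shows "inverse z \<in> F"
proof (cases "z = 0")
  case True
  with rats show ?thesis by auto
next
  case False
  have poly_in: "poly p z \<in> F" if "poly_over \<rat> p" for p
    using that
  proof (induction p)
    case 0
    then show ?case using rats by auto
  next
    case (pCons a p)
    have "a \<in> \<rat>"
      using pCons.prems by (metis coeff_pCons_0 poly_over_def)
    moreover have "poly_over \<rat> p"
      using pCons.prems by (metis coeff_pCons_Suc poly_over_def)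
    ultimately show ?case
      using pCons.IH rats add mult \<open>z \<in> F\<close> by auto
  qed
  have "inverse z \<in> F" if "p \<noteq> 0" "poly_over \<rat> p" "poly p z = 0" for p
    using that
  proof (induction p)
    case (pCons a p)
    have a: "a \<in> \<rat>"
      using pCons.prems by (metis coeff_pCons_0 poly_over_def)
    have p: "poly_over \<rat> p"
      using pCons.prems by (metis coeff_pCons_Suc poly_over_def)
    show ?case
    proof (cases "a = 0")
      case True
      with pCons p False show ?thesis by auto
    next
      case a0: False
      from pCons.prems False a0 have "inverse z = (- inverse a) * poly p z"
        by (simp add: field_simps eq_neg_iff_add_eq_0)
      moreover have "- inverse a \<in> \<rat>" using a by auto
      ultimately show ?thesis
        using rats mult[OF _ poly_in[OF p]] by (metis subsetD)
    qed
  qed auto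
  moreover obtain p where "p \<noteq> 0" "poly_over \<rat> p" "poly p z = 0"
    using \<open>algebraic z\<close> Ints_subset_Rats unfolding algebraic_def poly_over_def by blast
  ultimately show ?thesis by blast
qed

text \<open>A partial embedding: \<open>f\<close> is total, but it is required to be a homomorphism
  only on the subfield \<open>F\<close>.\<close>

locale subfield_embedding =
  fixes F :: "'k :: field_char_0 set" and f :: "'k \<Rightarrow> complex"
  assumes rats: "\<rat> \<subseteq> F"
    and add_closed: "\<And>x y. x \<in> F \<Longrightarrow> y \<in> F \<Longrightarrow> x + y \<in> F"
    and mult_closed: "\<And>x y. x \<in> F \<Longrightarrow> y \<in> F \<Longrightarrow> x * y \<in> F"
    and inverse_closed: "\<And>x. x \<in> F \<Longrightarrow> inverse x \<in> F"
    and f_1: "f 1 = 1"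
    and f_add: "\<And>x y. x \<in> F \<Longrightarrow> y \<in> F \<Longrightarrow> f (x + y) = f x + f y"
    and f_mult: "\<And>x y. x \<in> F \<Longrightarrow> y \<in> F \<Longrightarrow> f (x * y) = f x * f y"
begin

lemma zero_closed: "0 \<in> F" and one_closed: "1 \<in> F" and minus_one_closed: "-1 \<in> F"
  using rats by auto

lemma uminus_closed: "x \<in> F \<Longrightarrow> - x \<in> F"
  using mult_closed[OF minus_one_closed, of x] by simp

lemma diff_closed: "x \<in> F \<Longrightarrow> y \<in> F \<Longrightarrow> x - y \<in> F"
  using add_closed[of x "- y"] uminus_closed[of y] by simp

lemma f_0: "f 0 = 0"
  using f_add[OF zero_closed zero_closed] by simp

lemma f_uminus: "x \<in> F \<Longrightarrow> f (- x) = - f x"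
  using f_add[of x "-x"] uminus_closed[of x] f_0 by (simp add: eq_neg_iff_add_eq_0 add.commute)

lemma f_diff: "x \<in> F \<Longrightarrow> y \<in> F \<Longrightarrow> f (x - y) = f x - f y"
  using f_add[of x "- y"] f_uminus[of y] uminus_closed[of y] by simp

lemma f_eq_0: "x \<in> F \<Longrightarrow> f x = 0 \<Longrightarrow> x = 0"
  using f_mult[of x "inverse x"] inverse_closed[of x] f_1 by (cases "x = 0") auto

lemma sum_closed: "(\<And>i. i \<in> A \<Longrightarrow> g i \<in> F) \<Longrightarrow> sum g A \<in> F"
  by (induction A rule: infinite_finite_induct) (auto intro: zero_closed add_closed)

lemma f_sum: "(\<And>i. i \<in> A \<Longrightarrow> g i \<in> F) \<Longrightarrow> f (sum g A) = (\<Sum>i\<in>A. f (g i))"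
  by (induction A rule: infinite_finite_induct) (auto simp: f_0 f_add sum_closed)

section \<open>Polynomials over the subfield and their images under the embedding\<close>

lemma poly_over_add: "poly_over F p \<Longrightarrow> poly_over F q \<Longrightarrow> poly_over F (p + q)"
  by (simp add: poly_over_def add_closed)

lemma poly_over_diff: "poly_over F p \<Longrightarrow> poly_over F q \<Longrightarrow> poly_over F (p - q)"
  by (simp add: poly_over_def diff_closed)

lemma poly_over_mult: "poly_over F p \<Longrightarrow> poly_over F q \<Longrightarrow> poly_over F (p * q)"
  by (simp add: poly_over_def coeff_mult sum_closed mult_closed)

lemma poly_over_monom: "a \<in> F \<Longrightarrow> poly_over F (monom a n)"
  by (simp add: poly_over_def zero_closed)

lemma poly_over_const: "a \<in> F \<Longrightarrow> poly_over F [:a:]"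
  using poly_over_monom[of a 0] by (simp add: monom_0)

lemma map_poly_add: "poly_over F p \<Longrightarrow> poly_over F q \<Longrightarrow>
    map_poly f (p + q) = map_poly f p + map_poly f q"
  by (intro poly_eqI) (simp add: poly_over_def coeff_map_poly f_0 f_add)

lemma map_poly_diff: "poly_over F p \<Longrightarrow> poly_over F q \<Longrightarrow>
    map_poly f (p - q) = map_poly f p - map_poly f q"
  by (intro poly_eqI) (simp add: poly_over_def coeff_map_poly f_0 f_diff)

lemma map_poly_mult: "poly_over F p \<Longrightarrow> poly_over F q \<Longrightarrow>
    map_poly f (p * q) = map_poly f p * map_poly f q"
  by (intro poly_eqI)
    (simp add: poly_over_def coeff_map_poly coeff_mult f_0 f_sum f_mult mult_closed)

lemma degree_map_poly: "poly_over F p \<Longrightarrow> degree (map_poly f p) = degree p"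
  by (cases "p = 0") (auto simp: poly_over_def dest!: f_eq_0 intro!: map_poly_degree_eq)

text \<open>By division with remainder, \<open>p\<close> is a multiple of \<open>m\<close> over \<open>F\<close>.\<close>

lemma root_of_min_poly_conjugate:
  assumes m: "poly_over F m" "m \<noteq> 0" "poly m x = 0"
    and min: "\<And>p. poly_over F p \<Longrightarrow> p \<noteq> 0 \<Longrightarrow> poly p x = 0 \<Longrightarrow> degree m \<le> degree p"
    and y: "poly (map_poly f m) y = 0"
    and p: "poly_over F p" "poly p x = 0"
  shows "poly (map_poly f p) y = 0"
  using p
proof (induction "degree p" arbitrary: p rule: less_induct)
  case less
  show ?case
  proof (cases "p = 0")
    case False
    define q where "q = monom (lead_coeff p * inverse (lead_coeff m)) (degree p - degree m)"
    have q: "poly_over F q"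
      unfolding q_def using less.prems m
      by (intro poly_over_monom mult_closed inverse_closed) (auto simp: poly_over_def)
    define r where "r = p - q * m"
    have r: "poly_over F r" "poly r x = 0"
      using less.prems m q by (auto simp: r_def intro!: poly_over_diff poly_over_mult)
    have le: "degree m \<le> degree p"
      using min less.prems False by blast
    have c: "lead_coeff p * inverse (lead_coeff m) \<noteq> 0"
      using False m(2) by simp
    have "degree q = degree p - degree m" "q \<noteq> 0"
      unfolding q_def using c by (simp_all only: degree_monom_eq monom_eq_0_iff not_False_eq_True)
    then have "degree (q * m) = degree p"
      using le m(2) by (simp add: degree_mult_eq)
    moreover have "lead_coeff q = lead_coeff p * inverse (lead_coeff m)"
      unfolding q_def by (rule lead_coeff_monom)
    then have "lead_coeff (q * m) = lead_coeff p"
      using m(2) by (simp add: lead_coeff_mult)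
    ultimately have "degree r \<le> degree p" "coeff r (degree p) = 0"
      unfolding r_def by (auto intro!: degree_diff_le)
    then have "degree r < degree p \<or> r = 0"
      using eq_zero_or_degree_less by blast
    then have "poly (map_poly f r) y = 0"
      using less.hyps[OF _ r] by auto
    moreover have "map_poly f r = map_poly f p - map_poly f q * map_poly f m"
      using less.prems m q
      by (simp add: r_def map_poly_diff map_poly_mult poly_over_mult)
    ultimately show ?thesis using y by simp
  qed auto
qed

text \<open>Take \<open>F'\<close> to be F[x] and send p(x) to the value at \<open>y\<close> of the
  image of p. This is well defined because every polynomial over \<open>F\<close> vanishing at
  \<open>x\<close> has an image vanishing at \<open>y\<close>, and F[x] is a field because
  \<open>x\<close> is algebraic.\<close>

theorem extend_embedding:
  assumes alg: "\<And>z :: 'k. algebraic z"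
    and m: "poly_over F m" "m \<noteq> 0" "poly m x = 0"
    and min: "\<And>p. poly_over F p \<Longrightarrow> p \<noteq> 0 \<Longrightarrow> poly p x = 0 \<Longrightarrow> degree m \<le> degree p"
    and y: "poly (map_poly f m) y = 0"
  obtains F' f' where "subfield_embedding F' f'" "x \<in> F'" "f' x = y"
    "F \<subseteq> F'" "\<And>z. z \<in> F \<Longrightarrow> f' z = f z"
proof -
  define F' where "F' = {poly p x | p. poly_over F p}"
  \<comment> \<open>The choice picks some polynomial representing \<open>z\<close>; the next fact
    shows that any other representative gives the same value.\<close>
  define f' where "f' z = poly (map_poly f (SOME p. poly_over F p \<and> poly p x = z)) y" for z
  have f': "f' (poly p x) = poly (map_poly f p) y" if "poly_over F p" for p
  proof -
    let ?q = "SOME q. poly_over F q \<and> poly q x = poly p x"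
    have q: "poly_over F ?q \<and> poly ?q x = poly p x"
      by (rule someI[of _ p]) (simp add: that)
    then have "poly (map_poly f (p - ?q)) y = 0"
      using that by (intro root_of_min_poly_conjugate[OF m min y])
        (auto intro: poly_over_diff)
    with q that show ?thesis
      by (simp add: f'_def map_poly_diff)
  qed
  have sub: "F \<subseteq> F'"
  proof
    fix a assume "a \<in> F"
    then show "a \<in> F'"
      unfolding F'_def by (auto intro!: exI[of _ "[:a:]"] poly_over_const)
  qed
  have X: "poly_over F [:0, 1:]"
    using poly_over_monom[OF one_closed, of 1] by (simp add: monom_altdef)
  have fX: "map_poly f [:0, 1:] = [:0, 1:]"
    by (simp add: map_poly_pCons f_0 f_1)
  have add: "a + b \<in> F'" "f' (a + b) = f' a + f' b" if ab: "a \<in> F'" "b \<in> F'" for a b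
  proof -
    obtain p q where pq: "poly_over F p" "a = poly p x" "poly_over F q" "b = poly q x"
      using ab unfolding F'_def by blast
    then have "a + b = poly (p + q) x" by simp
    with pq poly_over_add[of p q] show "a + b \<in> F'"
      unfolding F'_def by blast
    show "f' (a + b) = f' a + f' b"
      using f'[of "p + q"] f'[of p] f'[of q] pq poly_over_add[of p q] map_poly_add[of p q] by simp
  qed
  have mult: "a * b \<in> F'" "f' (a * b) = f' a * f' b" if ab: "a \<in> F'" "b \<in> F'" for a b
  proof -
    obtain p q where pq: "poly_over F p" "a = poly p x" "poly_over F q" "b = poly q x"
      using ab unfolding F'_def by blast
    then have "a * b = poly (p * q) x" by simp
    with pq poly_over_mult[of p q] show "a * b \<in> F'"
      unfolding F'_def by blast
    show "f' (a * b) = f' a * f' b"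
      using f'[of "p * q"] f'[of p] f'[of q] pq poly_over_mult[of p q] map_poly_mult[of p q] by simp
  qed
  have "subfield_embedding F' f'"
  proof
    show "\<rat> \<subseteq> F'" using rats sub by blast
    then show "inverse a \<in> F'" if "a \<in> F'" for a
      using that alg add(1) mult(1) by (rule_tac inverse_in_algebraic_subring) auto
    show "f' 1 = 1"
      using f'[OF poly_over_const[OF one_closed]] by (simp add: map_poly_pCons f_1 f_0)
  qed (use add mult in auto)
  moreover have "x \<in> F'"
    using X unfolding F'_def by (auto intro!: exI[of _ "[:0, 1:]"])
  moreover have "f' x = y"
    using f'[OF X] fX by simp
  moreover have "f' z = f z" if "z \<in> F" for z
    using f'[OF poly_over_const[OF that]] by (simp add: Polynomial.map_poly_pCons f_0)
  ultimately show ?thesis using sub that by blast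
qed

text \<open>The minimal polynomial of \<open>x\<close> over \<open>F\<close> keeps its positive
  degree under \<open>f\<close>, so its image has a complex root, and any such root can serve as the
  image of \<open>x\<close>.\<close>

corollary extend_embedding_exists:
  assumes alg: "\<And>z :: 'k. algebraic z"
  obtains F' f' where "subfield_embedding F' f'" "x \<in> F'"
    "F \<subseteq> F'" "\<And>z. z \<in> F \<Longrightarrow> f' z = f z"
proof -
  let ?I = "\<lambda>p. poly_over F p \<and> p \<noteq> 0 \<and> poly p x = 0"
  obtain p where "?I p"
    using alg[of x] rats Ints_subset_Rats unfolding algebraic_def poly_over_def by blast
  from ex_has_least_nat[of ?I, OF this, of degree] obtain m where
    m: "poly_over F m" "m \<noteq> 0" "poly m x = 0" and min: "\<And>q. poly_over F q \<Longrightarrow> q \<noteq> 0 \<Longrightarrow> poly q x = 0 \<Longrightarrow> degree m \<le> degree q"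
    by blast
  have "degree m \<noteq> 0"
  proof
    assume "degree m = 0"
    then obtain c where "m = [:c:]"
      by (elim degree_eq_zeroE)
    with m(2,3) show False by simp
  qed
  then have "degree (map_poly f m) > 0"
    using m(1) by (simp add: degree_map_poly)
  then obtain y where y: "poly (map_poly f m) y = 0"
    using alg_closed_imp_poly_has_root by metis
  show ?thesis
  proof (rule extend_embedding[of m x y])
    show "degree m \<le> degree p" if "poly_over F p" "p \<noteq> 0" "poly p x = 0" for p
      using that by (rule min)
  qed (use alg m y that in auto)
qed

end

text \<open>The start of the tower of extensions. \<open>of_rat\<close> is injective in
  characteristic 0, so \<open>the_inv of_rat\<close> recovers the rational number behind an element
  of the prime field.\<close>

lemma rats_embedding:
  "subfield_embedding \<rat> (\<lambda>z :: 'k :: field_char_0. of_rat (the_inv of_rat z))"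
proof -
  have the_inv: "the_inv of_rat (of_rat q :: 'k) = q" for q
    by (intro the_inv_f_f injI) simp
  show ?thesis
  proof
    fix x y :: 'k
    assume "x \<in> \<rat>" "y \<in> \<rat>"
    then obtain p q where "x = of_rat p" "y = of_rat q"
      by (auto elim!: Rats_cases)
    then show
      "(of_rat (the_inv of_rat (x + y)) :: complex) = of_rat (the_inv of_rat x) + of_rat (the_inv of_rat y)"
      "(of_rat (the_inv of_rat (x * y)) :: complex) = of_rat (the_inv of_rat x) * of_rat (the_inv of_rat y)"
      by (simp_all add: the_inv flip: of_rat_add of_rat_mult)
  next
    show "(of_rat (the_inv of_rat (1 :: 'k)) :: complex) = 1"
      using the_inv[of 1] by simp
  qed auto
qed

text \<open>Lets minimality of degree among integer polynomials pass to rational ones, since scaling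
  by \<open>D\<close> changes neither the degree nor the roots.\<close>

lemma rat_poly_clear_denominators:
  fixes p :: "'k :: field_char_0 poly"
  assumes "poly_over \<rat> p"
  obtains D P where "D \<noteq> 0" "of_int_poly P = smult (of_int D) p"
proof -
  have "\<forall>i. \<exists>q. coeff p i = of_rat q"
    using assms unfolding poly_over_def Rats_def by blast
  then obtain u where u: "\<And>i. coeff p i = of_rat (u i)"
    by metis
  obtain D where D: "D \<noteq> 0" "\<forall>i\<in>{..degree p}. \<exists>k. of_int D * u i = of_int k"
    using finite_common_denominator[of "{..degree p}" u] by blast
  then obtain k where k: "\<And>i. i \<le> degree p \<Longrightarrow> of_int D * u i = of_int (k i)"
    unfolding Ball_def atMost_iff by metis
  let ?P = "\<Sum>i\<le>degree p. monom (k i) i"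
  have "coeff (of_int_poly ?P) i = coeff (smult (of_int D) p) i" for i
  proof (cases "i \<le> degree p")
    case True
    then have "of_int (k i) = (of_int D * of_rat (u i) :: 'k)"
      using k by (metis of_rat_mult of_rat_of_int_eq)
    with True show ?thesis
      by (simp add: coeff_map_poly coeff_sum u)
  next
    case False
    then show ?thesis
      by (simp add: coeff_map_poly coeff_sum coeff_eq_0)
  qed
  then have "of_int_poly ?P = smult (of_int D) p"
    by (rule poly_eqI)
  with D show ?thesis using that by blast
qed

text \<open>Extend the embedding of the rationals by sending \<open>x\<close> to \<open>y\<close>,
  then adjoin the elements of a finite spanning set \<open>B\<close> one at a time. The resulting
  subfield is a rational subspace containing \<open>B\<close>, hence the whole field.\<close>

theorem embedding_of_min_poly_root:
  fixes x :: "'k :: field_char_0"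
  assumes "number_field TYPE('k)"
    and m: "m \<noteq> 0" "poly (of_int_poly m) x = 0"
    and min: "\<And>p :: int poly. p \<noteq> 0 \<Longrightarrow> poly (of_int_poly p) x = 0 \<Longrightarrow> degree m \<le> degree p"
    and y: "poly (of_int_poly m) y = 0"
  obtains \<sigma> :: "'k \<Rightarrow> complex" where "field_hom \<sigma>" "\<sigma> x = y"
proof -
  have alg: "algebraic z" for z :: 'k
  proof -
    obtain p where "p \<noteq> 0" "poly (of_int_poly p) z = 0"
      using number_field_algebraic_bounded_degree[OF assms(1)] by metis
    then show ?thesis
      unfolding algebraic_def by (intro exI[of _ "of_int_poly p"]) (simp add: coeff_map_poly)
  qed
  let ?f = "\<lambda>z :: 'k. of_rat (the_inv of_rat z) :: complex"
  interpret R: subfield_embedding \<rat> ?f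
    by (rule rats_embedding)
  have "?f (of_int k) = of_int k" for k
  proof -
    have "the_inv of_rat (of_rat (of_int k) :: 'k) = of_int k"
      by (intro the_inv_f_f injI) simp
    then show ?thesis by simp
  qed
  then have fm: "map_poly ?f (of_int_poly m) = of_int_poly m"
    by (intro poly_eqI) (simp add: coeff_map_poly R.f_0)
  have min': "degree (of_int_poly m :: 'k poly) \<le> degree p"
    if p: "poly_over \<rat> p" "p \<noteq> 0" "poly p x = 0" for p
  proof -
    obtain D P where P: "D \<noteq> 0" "of_int_poly P = smult (of_int D) p"
      using rat_poly_clear_denominators[OF p(1)] .
    then have "P \<noteq> 0"
      using p(2) by auto
    moreover have "poly (of_int_poly P) x = 0"
      using P p by simp
    moreover have "degree P = degree p"
      using arg_cong[OF P(2), of degree] P(1) by simp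
    ultimately show ?thesis
      using min[of P] by simp
  qed
  have m': "poly_over \<rat> (of_int_poly m :: 'k poly)" "(of_int_poly m :: 'k poly) \<noteq> 0"
    using m(1) by (simp_all add: poly_over_def coeff_map_poly)
  have y': "poly (map_poly ?f (of_int_poly m)) y = 0"
    using y by (simp only: fm)
  have "\<exists>F f. subfield_embedding F f \<and> x \<in> F \<and> f x = y"
    by (rule R.extend_embedding[OF alg m' m(2) min' y']) blast+
  then obtain F f where F: "subfield_embedding F f" "x \<in> F" "f x = y"
    by blast
  obtain B :: "'k set" where B: "finite B"
    "module.span (\<lambda>(q :: rat) x. of_rat q * x) B = UNIV"
    using assms(1) unfolding number_field_def by blast
  have "\<exists>F f. subfield_embedding F f \<and> x \<in> F \<and> f x = y \<and> B \<subseteq> F"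
    using B(1)
  proof induction
    case empty
    show ?case using F by blast
  next
    case (insert b B)
    then obtain F f where F: "subfield_embedding F f" "x \<in> F" "f x = y" "B \<subseteq> F"
      by blast
    obtain F' f' where "subfield_embedding F' f'" "b \<in> F'"
      "F \<subseteq> F'" "\<And>z. z \<in> F \<Longrightarrow> f' z = f z"
      by (rule subfield_embedding.extend_embedding_exists[OF F(1) alg, of b]) (rule that)
    with F show ?case by (intro exI[of _ F'] exI[of _ f']) auto
  qed
  then obtain F f where F: "subfield_embedding F f" "f x = y" "B \<subseteq> F"
    by blast
  interpret subfield_embedding F f by (rule F)
  interpret Q: vector_space "\<lambda>(q :: rat) x :: 'k. of_rat q * x"
    by unfold_locales (auto simp: algebra_simps of_rat_add of_rat_mult)
  have "Q.subspace F"
    unfolding Q.subspace_def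
    using rats by (auto intro!: zero_closed add_closed mult_closed)
  with B(2) F(3) have "F = UNIV"
    using Q.span_minimal by blast
  then have "field_hom f"
    by unfold_locales (auto simp: f_0 f_1 f_add f_mult)
  with F(2) show ?thesis by (rule that[rotated])
qed

subsection \<open>Finiteness\<close>

text \<open>Multiplying by X - a turns the i-th coefficient into c_(i-1) - a c_i, so a bound on all
  coefficients grows at most by the factor \<open>1 + M\<close>.\<close>

lemma norm_coeff_prod_linear_le:
  fixes A :: "complex multiset"
  assumes "\<And>x. x \<in># A \<Longrightarrow> norm x \<le> M" "M \<ge> 0"
  shows "norm (coeff (\<Prod>x\<in>#A. [:- x, 1:]) i) \<le> (1 + M) ^ size A"
  using assms(1)
proof (induction A arbitrary: i)
  case empty
  then show ?case by (simp add: coeff_1 split: nat.split)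
next
  case (add a A)
  define P where "P = (\<Prod>x\<in>#A. [:- x, 1:])"
  have IH: "norm (coeff P j) \<le> (1 + M) ^ size A" for j
    unfolding P_def using add by simp
  have "norm (case i of 0 \<Rightarrow> 0 | Suc j \<Rightarrow> coeff P j) \<le> (1 + M) ^ size A"
    using IH \<open>M \<ge> 0\<close> by (cases i) auto
  moreover have "norm (a * coeff P i) \<le> M * (1 + M) ^ size A"
    unfolding norm_mult using IH add.prems \<open>M \<ge> 0\<close> by (intro mult_mono) auto
  moreover have "coeff ([:- a, 1:] * P) i = (case i of 0 \<Rightarrow> 0 | Suc j \<Rightarrow> coeff P j) - a * coeff P i"
    by (simp add: coeff_pCons split: nat.split)
  ultimately have "norm (coeff ([:- a, 1:] * P) i) \<le> (1 + M) ^ size A + M * (1 + M) ^ size A"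
    by (metis add_mono norm_triangle_ineq4 order_trans)
  then show ?case
    by (simp add: P_def algebra_simps)
qed

lemma finite_int_polys_bounded:
  "finite {p :: int poly. degree p \<le> d \<and> (\<forall>i. \<bar>coeff p i\<bar> \<le> N)}" (is "finite ?P")
proof (rule finite_subset)
  let ?L = "{xs. set xs \<subseteq> {- N..N} \<and> length xs \<le> Suc d}"
  show "finite (Poly ` ?L)"
    by (intro finite_imageI finite_lists_length_le) simp
  show "?P \<subseteq> Poly ` ?L"
  proof
    fix p :: "int poly"
    assume p: "p \<in> ?P"
    have "set (coeffs p) \<subseteq> {- N..N}"
      using p by (auto simp: coeffs_def abs_le_iff minus_le_iff)
    moreover have "length (coeffs p) \<le> Suc d"
      using p by (simp add: coeffs_def)
    ultimately show "p \<in> Poly ` ?L"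
      by (intro image_eqI[of _ _ "coeffs p"]) auto
  qed
qed

section \<open>Real and complex embeddings\<close>

lemma field_hom_poly_of_int_poly:
  assumes "field_hom \<sigma>"
  shows "\<sigma> (poly (of_int_poly p) x) = poly (of_int_poly p) (\<sigma> x)"
proof -
  interpret field_hom \<sigma> by (rule assms)
  show ?thesis
    by (induction p) (simp_all add: hom_distribs)
qed

text \<open>All images of \<open>x\<close> are real roots of one and the same integer polynomial,
  and these are finitely many.\<close>

lemma bounded_real_conjugates:
  fixes x :: "'k :: field_char_0"
  assumes "number_field TYPE('k)"
  obtains M where "M \<ge> 0" "\<And>\<sigma> :: 'k \<Rightarrow> real. field_hom \<sigma> \<Longrightarrow> \<sigma> x \<le> M"
proof -
  obtain p where p: "p \<noteq> 0" "poly (of_int_poly p) x = 0"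
    using number_field_algebraic_bounded_degree[OF assms] by metis
  \<comment> \<open>Inserting 0 makes the set nonempty and its maximum nonnegative.\<close>
  let ?R = "insert 0 {t :: real. poly (of_int_poly p) t = 0}"
  have fin: "finite ?R"
    using p by (simp add: poly_roots_finite)
  show ?thesis
  proof (rule that)
    show "Max ?R \<ge> 0"
      using fin by (intro Max_ge) auto
    fix \<sigma> :: "'k \<Rightarrow> real"
    assume \<sigma>: "field_hom \<sigma>"
    then interpret field_hom \<sigma> .
    have "poly (of_int_poly p) (\<sigma> x) = 0"
      using field_hom_poly_of_int_poly[OF \<sigma>, of p x] p by simp
    then show "\<sigma> x \<le> Max ?R"
      using fin by (intro Max_ge) auto
  qed
qed

text \<open>Connects \<open>totally_real\<close>, which speaks of complex embeddings, with
  \<open>totally_positive\<close>, which speaks of real ones.\<close>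

lemma field_hom_Re:
  fixes \<sigma> :: "'k :: field_char_0 \<Rightarrow> complex"
  assumes "totally_real TYPE('k)" "field_hom \<sigma>"
  shows "field_hom (\<lambda>x. Re (\<sigma> x))" "\<sigma> x = of_real (Re (\<sigma> x))"
proof -
  interpret field_hom \<sigma> by (rule assms)
  have real: "\<sigma> x = of_real (Re (\<sigma> x))" for x
    using assms unfolding totally_real_def by (metis of_real_Re range_subsetD)
  then show "\<sigma> x = of_real (Re (\<sigma> x))" .
  have im: "Im (\<sigma> x) = 0" for x
    by (subst real) simp
  show "field_hom (\<lambda>x. Re (\<sigma> x))"
    by unfold_locales (simp_all add: hom_distribs im)
qed

text \<open>Apply the conjugate construction to \<open>1\<close>, whose minimal polynomial is X - 1.
  A real embedding must exist for total positivity not to be vacuous; it is what keeps 0 from being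
  totally positive.\<close>

lemma number_field_real_embedding:
  assumes "number_field TYPE('k :: field_char_0)" "totally_real TYPE('k :: field_char_0)"
  obtains \<sigma> :: "'k :: field_char_0 \<Rightarrow> real" where "field_hom \<sigma>"
proof -
  have "degree [:-1, 1 :: int:] \<le> degree p"
    if "p \<noteq> 0" "poly (of_int_poly p) (1 :: 'k) = 0" for p
  proof (rule ccontr)
    assume "\<not> ?thesis"
    then have "degree p = 0" by simp
    then obtain c where "p = [:c:]"
      by (elim degree_eq_zeroE)
    with that show False by simp
  qed
  then obtain \<sigma> :: "'k \<Rightarrow> complex" where "field_hom \<sigma>"
    using embedding_of_min_poly_root[OF assms(1), of "[:-1, 1:]" 1 1] by auto
  then show ?thesis
    using field_hom_Re(1)[OF assms(2)] that by blast
qed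

text \<open>Northcott's argument: degree and conjugates are bounded independently of \<beta>, so
  only finitely many minimal polynomials occur.\<close>

theorem finite_pos_integers_below:
  fixes \<alpha> :: "'k :: field_char_0"
  assumes nf: "number_field TYPE('k)" and tr: "totally_real TYPE('k)"
  shows "finite {\<beta> \<in> pos_integers. \<alpha> \<succeq> \<beta>}"
proof -
  obtain d where d: "\<And>x :: 'k. \<exists>p. p \<noteq> 0 \<and> degree p \<le> d \<and> poly (of_int_poly p) x = 0"
    using number_field_algebraic_bounded_degree[OF nf] by blast
  obtain M where M: "M \<ge> 0" "\<And>\<sigma> :: 'k \<Rightarrow> real. field_hom \<sigma> \<Longrightarrow> \<sigma> \<alpha> \<le> M"
    using bounded_real_conjugates[OF nf] by blast
  \<comment> \<open>At most \<open>d\<close> roots of absolute value at most \<open>M\<close> bound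
    the coefficients by \<open>(1 + M) ^ d\<close>; the floor is allowed because they are integers.
    The zero polynomial is removed later, since it vanishes everywhere.\<close>
  define P where "P = {p :: int poly. degree p \<le> d \<and> (\<forall>i. \<bar>coeff p i\<bar> \<le> \<lfloor>(1 + M) ^ d\<rfloor>)}"
  have "\<exists>p\<in>P - {0}. poly (of_int_poly p) \<beta> = 0" if \<beta>: "\<beta> \<in> pos_integers" "\<alpha> \<succeq> \<beta>" for \<beta>
  proof -
    have "algebraic_int \<beta>" and tp: "totally_positive \<beta>"
      using \<beta> by (auto simp: pos_integers_def ring_of_integers_def)
    then obtain m where m: "lead_coeff m = 1" "poly (of_int_poly m) \<beta> = 0"
      and min: "\<And>p :: int poly. p \<noteq> 0 \<Longrightarrow> poly (of_int_poly p) \<beta> = 0 \<Longrightarrow> degree m \<le> degree p"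
      using algebraic_int_minimal_polynomial by metis
    have "m \<noteq> 0" using m(1) by auto
    have deg: "degree m \<le> d"
      using d[of \<beta>] min by (meson order_trans)
    \<comment> \<open>The hypotheses on \<beta> control only real embeddings; an arbitrary complex
      root is reached because the embedding sending \<beta> to it takes real values.\<close>
    have root: "norm y \<le> M" if y: "poly (of_int_poly m) y = 0" for y :: complex
    proof -
      obtain \<sigma> :: "'k \<Rightarrow> complex" where \<sigma>: "field_hom \<sigma>" "\<sigma> \<beta> = y"
        using embedding_of_min_poly_root[OF nf \<open>m \<noteq> 0\<close> m(2) min y] by blast
      define \<tau> where "\<tau> = (\<lambda>x. Re (\<sigma> x))"
      have \<tau>: "field_hom \<tau>" and y_eq: "y = of_real (\<tau> \<beta>)"
        using field_hom_Re[OF tr \<sigma>(1)] \<sigma>(2) by (auto simp: \<tau>_def)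
      interpret field_hom \<tau> by (rule \<tau>)
      have "\<tau> \<beta> > 0"
        using tp \<tau> unfolding totally_positive_def by blast
      moreover have "\<tau> \<beta> \<le> \<tau> \<alpha>"
        using \<beta>(2) \<tau> unfolding tp_greater_eq_def tp_greater_def totally_positive_def
        by (fastforce simp: hom_distribs)
      ultimately show ?thesis
        using M(2)[OF \<tau>] y_eq by simp
    qed
    let ?m = "of_int_poly m :: complex poly"
    obtain A where A: "size A = degree ?m" "?m = smult (lead_coeff ?m) (\<Prod>x\<in>#A. [:- x, 1:])"
      using alg_closed_imp_factorization[of ?m] \<open>m \<noteq> 0\<close> by auto
    have prod: "?m = (\<Prod>x\<in>#A. [:- x, 1:])"
      using A(2) m(1) by simp
    have "norm x \<le> M" if "x \<in># A" for x
    proof (rule root)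
      have "poly (\<Prod>x\<in>#A. [:- x, 1:]) x = (\<Prod>z\<in>#A. x - z)"
        by (simp add: poly_prod_mset)
      also have "\<dots> = 0"
        using that by (auto simp: prod_mset_zero_iff)
      finally show "poly ?m x = 0"
        by (simp only: prod)
    qed
    moreover have "size A = degree m"
      using A(1) by simp
    ultimately have "norm (coeff ?m i) \<le> (1 + M) ^ degree m" for i
      using norm_coeff_prod_linear_le[of A M i] M(1) unfolding prod by simp
    then have "\<bar>of_int (coeff m i)\<bar> \<le> (1 + M) ^ d" for i
      using power_increasing[OF deg, of "1 + M"] M(1) by (simp add: coeff_map_poly) (meson order_trans)
    then have "\<bar>coeff m i\<bar> \<le> \<lfloor>(1 + M) ^ d\<rfloor>" for i
      by (metis le_floor_iff of_int_abs)
    with deg \<open>m \<noteq> 0\<close> m(2) show ?thesis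
      by (auto simp: P_def)
  qed
  then have "{\<beta> \<in> pos_integers. \<alpha> \<succeq> \<beta>} \<subseteq> (\<Union>p\<in>P - {0}. {x. poly (of_int_poly p) x = 0})"
    by auto
  moreover have "finite \<dots>"
    unfolding P_def by (intro finite_UN_I finite_Diff finite_int_polys_bounded) (simp add: poly_roots_finite)
  ultimately show ?thesis
    by (rule finite_subset)
qed

subsection \<open>Partitions\<close>

text \<open>The polynomial n^d p(X/n) has the scaled root; its coefficients n^(d-i) p_i are
  integers, and the one at i = d is still 1.\<close>

lemma algebraic_int_of_nat_mult:
  fixes x :: "'k :: field_char_0"
  assumes "algebraic_int x"
  shows "algebraic_int (of_nat n * x)"
proof -
  obtain p where p: "poly (of_int_poly p) x = 0" "lead_coeff p = 1"
    using assms unfolding algebraic_int_altdef_ipoly by blast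
  define d where "d = degree p"
  define q where "q = (\<Sum>i\<le>d. monom (int n ^ (d - i) * coeff p i) i)"
  have coeff_q: "coeff q i = (if i \<le> d then int n ^ (d - i) * coeff p i else 0)" for i
    by (simp add: q_def coeff_sum)
  have "degree q \<le> d"
    by (rule degree_le) (simp add: coeff_q)
  moreover have "coeff q d = 1"
    using p(2) by (simp add: coeff_q d_def)
  ultimately have "lead_coeff q = 1"
    by (metis le_antisym le_degree zero_neq_one)
  moreover have "poly (of_int_poly q) (of_nat n * x) = 0"
  proof -
    have "poly (of_int_poly q) (of_nat n * x) =
        (\<Sum>i\<le>d. of_nat n ^ (d - i) * of_int (coeff p i) * (of_nat n * x) ^ i)"
      unfolding q_def by (simp add: of_int_poly_hom.hom_sum poly_sum map_poly_monom poly_monom)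
    also have "\<dots> = (\<Sum>i\<le>d. of_nat n ^ d * (of_int (coeff p i) * x ^ i))"
    proof (rule sum.cong)
      fix i assume "i \<in> {..d}"
      then have "(of_nat n :: 'k) ^ d = of_nat n ^ (d - i) * of_nat n ^ i"
        by (simp flip: power_add)
      then show "of_nat n ^ (d - i) * of_int (coeff p i) * (of_nat n * x) ^ i =
          of_nat n ^ d * (of_int (coeff p i) * x ^ i)"
        by (simp add: power_mult_distrib)
    qed simp
    also have "\<dots> = of_nat n ^ d * poly (of_int_poly p) x"
      by (simp add: poly_altdef d_def sum_distrib_left)
    finally show ?thesis
      using p(1) by simp
  qed
  ultimately show ?thesis
    unfolding algebraic_int_altdef_ipoly by blast
qed

lemma totally_positive_add:
  fixes x y :: "'k :: field_char_0"
  assumes "totally_positive x" "totally_positive y"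
  shows "totally_positive (x + y)"
  unfolding totally_positive_def
proof (intro allI impI)
  fix \<sigma> :: "'k \<Rightarrow> real"
  assume \<sigma>: "field_hom \<sigma>"
  then interpret field_hom \<sigma> .
  show "0 < \<sigma> (x + y)"
    using assms \<sigma> by (simp add: hom_add totally_positive_def add_pos_pos)
qed

lemma totally_positive_of_nat_mult_iff:
  assumes "n \<ge> 1"
  shows "totally_positive (of_nat n * x) \<longleftrightarrow> totally_positive x"
proof -
  have "0 < \<sigma> (of_nat n * x) \<longleftrightarrow> 0 < \<sigma> x" if "field_hom \<sigma>" for \<sigma> :: "'a \<Rightarrow> real"
  proof -
    interpret field_hom \<sigma> by (rule that)
    show ?thesis
      using assms by (simp add: hom_distribs zero_less_mult_iff)
  qed
  then show ?thesis
    unfolding totally_positive_def by blast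
qed

lemma totally_positive_sum_mset:
  assumes "A \<noteq> {#}" "\<And>x. x \<in># A \<Longrightarrow> totally_positive x"
  shows "totally_positive (\<Sum>\<^sub># A)"
  using assms
proof (induction A)
  case (add x A)
  then show ?case
    by (cases "A = {#}") (auto intro: totally_positive_add)
qed simp

text \<open>Admitting the empty multiset absorbs the convention p(0) = 1 into a plain
  cardinality.\<close>

definition pos_multisets :: "'k :: field_char_0 \<Rightarrow> 'k multiset set" where
  "pos_multisets \<delta> = {A. set_mset A \<subseteq> pos_integers \<and> \<Sum>\<^sub># A = \<delta>}"

text \<open>The difference is the sum of the remaining summands \<open>A - B\<close>, which is
  either empty or totally positive.\<close>

lemma pos_multisets_submultiset:
  assumes "A \<in> pos_multisets \<alpha>" "B \<subseteq># A"
  shows "\<alpha> \<succeq> \<Sum>\<^sub># B"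
proof -
  have "\<alpha> - \<Sum>\<^sub># B = \<Sum>\<^sub># (A - B)"
    using assms sum_mset_diff[of B A] by (simp add: pos_multisets_def)
  moreover have "totally_positive (\<Sum>\<^sub># (A - B))" if "A - B \<noteq> {#}"
    using that assms(1)
    by (intro totally_positive_sum_mset) (auto simp: pos_multisets_def pos_integers_def dest!: in_diffD)
  ultimately show ?thesis
    unfolding tp_greater_eq_def tp_greater_def
    by (metis eq_iff_diff_eq_0 sum_mset.empty)
qed

text \<open>The \<open>n\<close> copies of \<gamma> form a submultiset of \<open>A\<close>. The case
  n = 1 places every summand below \<alpha>.\<close>

lemma pos_multisets_count:
  assumes "A \<in> pos_multisets \<alpha>" "n \<ge> 1" "n \<le> count A \<gamma>"
  shows "\<gamma> \<in> pos_integers" "of_nat n * \<gamma> \<in> pos_integers" "\<alpha> \<succeq> of_nat n * \<gamma>"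
proof -
  have "\<gamma> \<in># A"
    using assms(2,3) by (simp flip: count_greater_zero_iff)
  then show \<gamma>: "\<gamma> \<in> pos_integers"
    using assms(1) by (auto simp: pos_multisets_def)
  then show "of_nat n * \<gamma> \<in> pos_integers"
    using assms(2) by (simp add: pos_integers_def ring_of_integers_def algebraic_int_of_nat_mult
        totally_positive_of_nat_mult_iff)
  show "\<alpha> \<succeq> of_nat n * \<gamma>"
    using pos_multisets_submultiset[OF assms(1), of "replicate_mset n \<gamma>"] assms(3)
    by (simp add: count_le_replicate_mset_subset_eq)
qed

text \<open>The summands come from a finite set on which \<tau> is at least some \<epsilon> > 0, so
  there are at most \<tau>(\<alpha>)/\<epsilon> of them.\<close>

lemma finite_pos_multisets:
  fixes \<alpha> :: "'k :: field_char_0"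
  assumes "field_hom (\<tau> :: 'k \<Rightarrow> real)" "finite {\<beta> \<in> pos_integers. \<alpha> \<succeq> \<beta>}"
  shows "finite (pos_multisets \<alpha>)"
proof -
  interpret field_hom \<tau> by (rule assms)
  let ?S = "{\<beta> \<in> pos_integers. \<alpha> \<succeq> \<beta>}"
  \<comment> \<open>The inserted 1 is a default for the case that \<open>?S\<close> is
    empty.\<close>
  define \<epsilon> where "\<epsilon> = Min (insert 1 (\<tau> ` ?S))"
  have pos: "\<tau> \<beta> > 0" if "\<beta> \<in> ?S" for \<beta>
    using that assms(1) by (auto simp: pos_integers_def totally_positive_def)
  have \<epsilon>: "\<epsilon> > 0"
    unfolding \<epsilon>_def using assms(2) pos by (subst Min_gr_iff) auto
  have \<epsilon>_le: "\<epsilon> \<le> \<tau> \<beta>" if "\<beta> \<in> ?S" for \<beta>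
    unfolding \<epsilon>_def using assms(2) that by (intro Min_le) auto
  have "pos_multisets \<alpha> \<subseteq> (\<Union>n\<le>nat \<lfloor>\<tau> \<alpha> / \<epsilon>\<rfloor>. multisets_of_size ?S n)"
  proof
    fix A assume A: "A \<in> pos_multisets \<alpha>"
    have sub: "set_mset A \<subseteq> ?S"
      using pos_multisets_count[OF A, of 1] by (auto simp: Suc_le_eq)
    have "\<epsilon> * size A = (\<Sum>x\<in>#A. \<epsilon>)"
      by simp
    also have "\<dots> \<le> (\<Sum>x\<in>#A. \<tau> x)"
      using sub \<epsilon>_le by (intro sum_mset_mono) auto
    also have "\<dots> = \<tau> (\<Sum>\<^sub># A)"
      by (induction A) (simp_all add: hom_distribs)
    also have "\<Sum>\<^sub># A = \<alpha>"
      using A by (simp add: pos_multisets_def)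
    finally have "size A \<le> \<tau> \<alpha> / \<epsilon>"
      using \<epsilon> by (simp add: field_simps)
    then have "size A \<le> nat \<lfloor>\<tau> \<alpha> / \<epsilon>\<rfloor>"
      by (simp add: le_nat_floor)
    with sub show "A \<in> (\<Union>n\<le>nat \<lfloor>\<tau> \<alpha> / \<epsilon>\<rfloor>. multisets_of_size ?S n)"
      by (auto simp: multisets_of_size_def)
  qed
  then show ?thesis
    by (rule finite_subset) (intro finite_UN_I finite_atMost finite_multisets_of_size assms(2))
qed

text \<open>A nonempty sum is totally positive while \<tau> maps 0 to 0, so only the empty multiset
  sums to 0.\<close>

lemma num_partitions_eq_card_pos_multisets:
  fixes \<alpha> :: "'k :: field_char_0"
  assumes "field_hom (\<tau> :: 'k \<Rightarrow> real)"
  shows "num_partitions \<alpha> = card (pos_multisets \<alpha>)"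
proof -
  interpret field_hom \<tau> by (rule assms)
  have "\<not> totally_positive (0 :: 'k)"
    using assms unfolding totally_positive_def by (metis hom_zero less_irrefl)
  then have "\<Sum>\<^sub># A \<noteq> 0" if "A \<noteq> {#}" "set_mset A \<subseteq> pos_integers" for A :: "'k multiset"
    using totally_positive_sum_mset[of A] that unfolding pos_integers_def by (metis (no_types, lifting) mem_Collect_eq subsetD)
  then have "pos_multisets (0 :: 'k) = {{#}}"
    unfolding pos_multisets_def by auto
  moreover have "partitions \<alpha> = pos_multisets \<alpha>" if "\<alpha> \<noteq> 0"
    unfolding partitions_def pos_multisets_def using that by auto
  ultimately show ?thesis
    by (simp add: num_partitions_def)
qed

text \<open>Adding \<open>n\<close> copies of \<gamma> inverts their removal; that \<gamma> is a
  totally positive integer makes the enlarged multiset admissible.\<close>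

lemma card_pos_multisets_count_ge:
  assumes "\<gamma> \<in> pos_integers"
  shows "card {A \<in> pos_multisets \<alpha>. n \<le> count A \<gamma>} = card (pos_multisets (\<alpha> - of_nat n * \<gamma>))"
proof (rule bij_betw_same_card)
  let ?r = "replicate_mset n \<gamma>"
  show "bij_betw (\<lambda>A. A - ?r) {A \<in> pos_multisets \<alpha>. n \<le> count A \<gamma>}
      (pos_multisets (\<alpha> - of_nat n * \<gamma>))"
  proof (rule bij_betw_byWitness[where f' = "\<lambda>A. A + ?r"])
    show "(\<lambda>A. A - ?r) ` {A \<in> pos_multisets \<alpha>. n \<le> count A \<gamma>} \<subseteq> pos_multisets (\<alpha> - of_nat n * \<gamma>)"
      by (auto simp: pos_multisets_def count_le_replicate_mset_subset_eq sum_mset_diff dest!: in_diffD)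
    show "(\<lambda>A. A + ?r) ` pos_multisets (\<alpha> - of_nat n * \<gamma>) \<subseteq> {A \<in> pos_multisets \<alpha>. n \<le> count A \<gamma>}"
      using assms by (auto simp: pos_multisets_def split: if_splits)
  qed (auto simp: count_le_replicate_mset_subset_eq)
qed

section \<open>Double counting of multiplicities and the recurrence\<close>

lemma sum_mset_eq_sum_count:
  fixes A :: "'a :: comm_semiring_1 multiset"
  assumes "finite S" "set_mset A \<subseteq> S"
  shows "\<Sum>\<^sub># A = (\<Sum>x\<in>S. of_nat (count A x) * x)"
  using assms(2)
proof (induction A)
  case (add a A)
  have "(\<Sum>x\<in>S. of_nat (count (add_mset a A) x) * x) =
      (\<Sum>x\<in>S. (if x = a then a else 0) + of_nat (count A x) * x)"
    by (intro sum.cong) (auto simp: algebra_simps)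
  with add assms(1) show ?case
    by (simp add: sum.distrib)
qed simp

text \<open>The multiplicity of \<gamma> in \<open>A\<close> is the number of \<open>n\<close> from
  1 up to it, all of which lie in \<open>N\<close>; then swap the two sums.\<close>

lemma sum_count_eq_sum_card:
  assumes "finite X" "finite N" "0 \<notin> N"
    and "\<And>A n. A \<in> X \<Longrightarrow> 1 \<le> n \<Longrightarrow> n \<le> count A \<gamma> \<Longrightarrow> n \<in> N"
  shows "(\<Sum>A\<in>X. count A \<gamma>) = (\<Sum>n\<in>N. card {A \<in> X. n \<le> count A \<gamma>})"
proof -
  have "count A \<gamma> = card {n \<in> N. n \<le> count A \<gamma>}" if "A \<in> X" for A
  proof -
    have "{n \<in> N. n \<le> count A \<gamma>} = {1..count A \<gamma>}"
      using assms(3) assms(4)[OF that] by (auto simp: Suc_le_eq intro: ccontr)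
    then show ?thesis by simp
  qed
  then have "(\<Sum>A\<in>X. count A \<gamma>) = (\<Sum>A\<in>X. \<Sum>n\<in>N. of_bool (n \<le> count A \<gamma>))"
    using assms(2) by (intro sum.cong) (simp_all add: Int_def)
  also have "\<dots> = (\<Sum>n\<in>N. \<Sum>A\<in>X. of_bool (n \<le> count A \<gamma>))"
    by (rule sum.swap)
  also have "\<dots> = (\<Sum>n\<in>N. card {A \<in> X. n \<le> count A \<gamma>})"
    using assms(1) by (simp add: Int_def)
  finally show ?thesis .
qed

theorem theorem1p1:
  fixes \<alpha> :: "'k :: field_char_0"
  assumes "number_field TYPE('k)"
    and "totally_real TYPE('k)"
    and "\<alpha> \<in> ring_of_integers"
    and "totally_positive \<alpha>"
  shows "\<alpha> * of_nat (num_partitions \<alpha>) =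
    (\<Sum>\<beta> \<in> {\<beta> \<in> ring_of_integers. \<beta> \<succ> 0 \<and> \<alpha> \<succeq> \<beta>}.
       divisor_sum \<beta> * of_nat (num_partitions (\<alpha> - \<beta>)))"
proof -
  obtain \<tau> :: "'k \<Rightarrow> real" where \<tau>: "field_hom \<tau>"
    using number_field_real_embedding[OF assms(1,2)] .
  interpret field_hom \<tau> by (rule \<tau>)
  define S where "S = {\<beta> \<in> pos_integers. \<alpha> \<succeq> \<beta>}"
  \<comment> \<open>For \<open>n \<ge> 1\<close> outside \<open>N \<gamma>\<close>, no partition of
    \<alpha> contains \<gamma> at least \<open>n\<close> times.\<close>
  define N where "N \<gamma> = {n. n \<ge> 1 \<and> of_nat n * \<gamma> \<in> S}" for \<gamma>
  define D where "D \<beta> = {n :: nat. n \<ge> 1 \<and> \<beta> / of_nat n \<in> ring_of_integers}" for \<beta> :: 'k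
  let ?P = "pos_multisets \<alpha>"
  let ?c = "\<lambda>\<delta>. of_nat (num_partitions \<delta>) :: 'k"
  note c_eq = num_partitions_eq_card_pos_multisets[OF \<tau>]
  have finS: "finite S"
    unfolding S_def using finite_pos_integers_below[OF assms(1,2)] .
  have finP: "finite ?P"
    using finite_pos_multisets[OF \<tau>] finS unfolding S_def .
  have pos: "\<tau> \<beta> > 0" if "\<beta> \<in> S" for \<beta>
    using that \<tau> by (auto simp: S_def pos_integers_def totally_positive_def)
  then have nonzero: "\<beta> \<noteq> 0" if "\<beta> \<in> S" for \<beta>
    using that by fastforce
  \<comment> \<open>Division by \<open>n\<close> stays below \<alpha> because \<beta> - \<beta>/n =
    (n - 1)(\<beta>/n); for n = 1 this is 0, which is not totally positive, hence the case
    distinction.\<close>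
  have S_div: "\<beta> / of_nat n \<in> S" if "\<beta> \<in> S" "n \<in> D \<beta>" for \<beta> n
  proof -
    have n: "n \<ge> 1" and \<beta>: "\<beta> = of_nat n * (\<beta> / of_nat n)"
      using that by (auto simp: D_def)
    have tp: "totally_positive (\<beta> / of_nat n)"
      using that n \<beta> totally_positive_of_nat_mult_iff[OF n, of "\<beta> / of_nat n"]
      by (simp add: S_def pos_integers_def)
    have "\<alpha> \<succeq> \<beta> / of_nat n"
    proof (cases "n = 1")
      case True
      with that show ?thesis by (simp add: S_def)
    next
      case False
      with n have "n - 1 \<ge> 1" by simp
      then have "totally_positive (of_nat (n - 1) * (\<beta> / of_nat n))"
        using tp totally_positive_of_nat_mult_iff by blast
      moreover have "of_nat (n - 1) * (\<beta> / of_nat n) = \<beta> - \<beta> / of_nat n"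
        using n by (simp add: of_nat_diff field_simps)
      ultimately have "totally_positive (\<beta> - \<beta> / of_nat n)"
        by simp
      then have "totally_positive (\<alpha> - \<beta> / of_nat n)"
        using that(1) totally_positive_add[of "\<alpha> - \<beta>" "\<beta> - \<beta> / of_nat n"]
        by (auto simp: S_def tp_greater_eq_def tp_greater_def)
      then show ?thesis
        by (simp add: tp_greater_eq_def tp_greater_def)
    qed
    with tp that show ?thesis
      by (simp add: S_def pos_integers_def D_def)
  qed
  \<comment> \<open>As \<gamma> is nonzero, n \<mapsto> n\<gamma> embeds \<open>N \<gamma>\<close>
    into the finite set \<open>S\<close>; for \<open>D \<beta>\<close> the map n \<mapsto> \<beta>/n
    does the same.\<close>
  have finN: "finite (N \<gamma>)" if "\<gamma> \<in> S" for \<gamma>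
  proof (rule inj_on_finite[OF _ _ finS])
    show "inj_on (\<lambda>n. of_nat n * \<gamma>) (N \<gamma>)"
      using nonzero[OF that] by (auto intro: inj_onI)
  qed (auto simp: N_def)
  have finD: "finite (D \<beta>)" if "\<beta> \<in> S" for \<beta>
  proof (rule inj_on_finite[OF _ _ finS])
    show "inj_on (\<lambda>n. \<beta> / of_nat n) (D \<beta>)"
      using nonzero[OF that] by (auto intro!: inj_onI simp: D_def)
    show "(\<lambda>n. \<beta> / of_nat n) ` D \<beta> \<subseteq> S"
      using S_div[OF that] by blast
  qed
  have count: "(\<Sum>A\<in>?P. count A \<gamma>) = (\<Sum>n\<in>N \<gamma>. num_partitions (\<alpha> - of_nat n * \<gamma>))"
    if \<gamma>: "\<gamma> \<in> S" for \<gamma>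
  proof -
    have "(\<Sum>A\<in>?P. count A \<gamma>) = (\<Sum>n\<in>N \<gamma>. card {A \<in> ?P. n \<le> count A \<gamma>})"
      using finP finN[OF \<gamma>] pos_multisets_count
      by (intro sum_count_eq_sum_card) (auto simp: N_def S_def)
    then show ?thesis
      using \<gamma> by (simp add: card_pos_multisets_count_ge c_eq S_def)
  qed
  have "\<alpha> * ?c \<alpha> = (\<Sum>A\<in>?P. \<Sum>\<^sub># A)"
    by (simp add: c_eq pos_multisets_def mult.commute)
  also have "\<dots> = (\<Sum>A\<in>?P. \<Sum>\<gamma>\<in>S. of_nat (count A \<gamma>) * \<gamma>)"
  proof (rule sum.cong)
    fix A assume A: "A \<in> ?P"
    have "set_mset A \<subseteq> S"
      using pos_multisets_count[OF A, of 1] by (auto simp: Suc_le_eq S_def)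
    then show "\<Sum>\<^sub># A = (\<Sum>\<gamma>\<in>S. of_nat (count A \<gamma>) * \<gamma>)"
      by (rule sum_mset_eq_sum_count[OF finS])
  qed simp
  also have "\<dots> = (\<Sum>\<gamma>\<in>S. of_nat (\<Sum>A\<in>?P. count A \<gamma>) * \<gamma>)"
    by (subst sum.swap) (simp add: sum_distrib_right)
  also have "\<dots> = (\<Sum>\<gamma>\<in>S. \<Sum>n\<in>N \<gamma>. \<gamma> * ?c (\<alpha> - of_nat n * \<gamma>))"
    by (intro sum.cong) (simp_all add: count sum_distrib_left sum_distrib_right mult.commute)
  also have "\<dots> = (\<Sum>(\<gamma>, n)\<in>Sigma S N. \<gamma> * ?c (\<alpha> - of_nat n * \<gamma>))"
    using finS finN by (simp add: sum.Sigma)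
  \<comment> \<open>Change of variables \<beta> = n\<gamma> with \<open>n\<close> kept: \<gamma>
    runs over the integral quotients \<beta>/n, and \<open>S_div\<close> shows that these lie in
    \<open>S\<close> again.\<close>
  also have "\<dots> = (\<Sum>(\<beta>, n)\<in>Sigma S D. \<beta> / of_nat n * ?c (\<alpha> - \<beta>))"
  proof (rule sum.reindex_bij_witness[where
        i = "\<lambda>(\<beta>, n). (\<beta> / of_nat n, n)" and j = "\<lambda>(\<gamma>, n). (of_nat n * \<gamma>, n)"])
    fix b assume "b \<in> Sigma S D"
    then show "(case b of (\<beta>, n) \<Rightarrow> (\<beta> / of_nat n, n)) \<in> Sigma S N"
      using S_div by (auto simp: N_def) (auto simp: D_def)
  qed (auto simp: N_def D_def S_def pos_integers_def)
  also have "\<dots> = (\<Sum>\<beta>\<in>S. \<Sum>n\<in>D \<beta>. \<beta> / of_nat n * ?c (\<alpha> - \<beta>))"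
    using finS finD by (simp add: sum.Sigma)
  also have "\<dots> = (\<Sum>\<beta>\<in>S. divisor_sum \<beta> * ?c (\<alpha> - \<beta>))"
    by (simp add: divisor_sum_def D_def sum_distrib_right)
  also have "S = {\<beta> \<in> ring_of_integers. \<beta> \<succ> 0 \<and> \<alpha> \<succeq> \<beta>}"
    by (auto simp: S_def pos_integers_def tp_greater_def)
  finally show ?thesis .
qed

end
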